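(* Let a Runge--Kutta method of order $p$ with $s$ stages and Shu--Osher coefficients $\alpha,\beta$ be applied with step size $\tau>0$ to the linear system $U'(t)=LU(t)+g(t)$, $U(t_0)=U_0$, where $L\in\mathbb{R}^{m\times m}$ is a normal matrix, and let $\mathcal{S}\subset\{z\in\mathbb{C}:|P(z)|\le 1\}$ be a set with $\tau\sigma(L)\subset\mathcal{S}$, where $\sigma(L)$ is the spectrum of $L$. Let $\epsilon_n=\widetilde U_n-U(t_n)$, where $U$ is the exact solution and $\widetilde U_n$ satisfies the perturbed Runge--Kutta equations with stage residuals $\tilde r_1,\dots,\tilde r_{s+1}\in\mathbb{R}^m$. Then $$\|\epsilon_{n+1}\|\le\|\epsilon_n\|+(s+1)\,\mathcal{M}(\alpha,\beta,\mathcal{S})\max_{1\le j\le s+1}\|\tilde r_j\|+\mathcal{O}(\tau^{p+1}).$$ The factor $s+1$ can be replaced by $s$ for explicit methods, since then $\tilde r_1=0$.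
   Context: Shu--Osher form: an $s$-stage Runge--Kutta method for $U'=F(t,U)$ is given by real $(s+1)\times(s+1)$ matrices $\alpha=[\alpha_{ij}]$, $\beta=[\beta_{ij}]$ whose last columns are zero, with $v_i=1-\sum_j\alpha_{ij}$: $$Y_i=v_iU_n+\sum_{j=1}^s\big(\alpha_{ij}Y_j+\tau\beta_{ij}F(t_n+c_j\tau,Y_j)\big)\ (1\le i\le s+1),\qquad U_{n+1}=Y_{s+1},$$ where $t_{n+1}=t_n+\tau$, $\alpha_{1:s},\beta_{1:s}$ denote the upper-left $s\times s$ blocks, $\alpha_{s+1},\beta_{s+1}$ the first $s$ entries of the last rows, $v_{1:s}=(v_1,\dots,v_s)^\top$, $I_s$ is the $s\times s$ identity matrix, $I_s-\alpha_{1:s}$ is assumed invertible, and $c=(c_1,\dots,c_s)^\top=(I_s-\alpha_{1:s})^{-1}\beta_{1:s}\mathbf{1}$ with $\mathbf{1}$ the vector of ones. Perturbed equations: $$\widetilde Y_i=v_i\widetilde U_n+\sum_{j=1}^s\big(\alpha_{ij}\widetilde Y_j+\tau\beta_{ij}F(t_n+c_j\tau,\widetilde Y_j)\big)+\tilde r_i\ (1\le i\le s+1),\qquad \widetilde U_{n+1}=\widetilde Y_{s+1}.$$ For an explicit method $\alpha$ and $\beta$ are strictly lower triangular, and $\tilde r_1=0$ because no error is made in setting $Y_1=U_n$. Stability function: $P(z)=v_{s+1}+(\alpha_{s+1}+z\beta_{s+1})(I_s-\alpha_{1:s}-z\beta_{1:s})^{-1}v_{1:s}$. Internal stability functions: $(Q_1(z),\dots,Q_s(z))=(\alpha_{s+1}+z\beta_{s+1})(I_s-\alpha_{1:s}-z\beta_{1:s})^{-1}$.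 Maximum internal amplification factor with respect to a set $\mathcal{S}\subset\mathbb{C}$: $\mathcal{M}(\alpha,\beta,\mathcal{S})=\max_{1\le j\le s}\sup_{z\in\mathcal{S}}|Q_j(z)|$. When $\mathcal{S}$ is not specified, it is taken to be the absolute stability region $\{z\in\mathbb{C}:|P(z)|\le1\}$. Here $\|\cdot\|$ is the Euclidean norm, $g:\mathbb{R}\to\mathbb{R}^m$ is smooth, and $\mathcal{O}(\tau^{p+1})$ is the local discretization error term of the method of order $p$, understood as $\tau\to0$ and not depending on the residuals.
   Formalization: The formal theorem additionally assumes that the maximum internal amplification factor M(α,β,S) is at least 1; without this the claim fails, e.g. for forward Euler with α=0, L=0, S={0}, where M=0 but the final residual enters the error with coefficient 1. *)

theory Defs
  imports
    "HOL-Analysis.Analysis"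
    "HOL-Library.Landau_Symbols"
    "Jordan_Normal_Form.Gauss_Jordan_Elimination"
begin

text \<open>
  The Shu--Osher arrays \<open>\<alpha>\<close>, \<open>\<beta>\<close> are \<open>(s+1) \<times> (s+1)\<close> matrices with indices starting at 0: the stages
  \<open>Y\<^sub>1, \<dots>, Y\<^sub>s\<close> have indices \<open>0, \<dots>, s - 1\<close>, and the final row, giving \<open>U\<^sub>n\<^sub>+\<^sub>1\<close>, has index \<open>s\<close>.
\<close>

definition inv_mat :: "'a::field mat \<Rightarrow> 'a mat" where
  "inv_mat A = the (mat_inverse A)"

definition lead_block :: "nat \<Rightarrow> 'a mat \<Rightarrow> 'a mat" where
  "lead_block s A = mat s s (\<lambda>(i, j). A $$ (i, j))"

definition last_row :: "nat \<Rightarrow> 'a mat \<Rightarrow> 'a Matrix.vec" where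
  "last_row s A = Matrix.vec s (\<lambda>j. A $$ (s, j))"

definition shu_osher :: "nat \<Rightarrow> real mat \<Rightarrow> real mat \<Rightarrow> bool" where
  "shu_osher s \<alpha> \<beta> \<longleftrightarrow>
     \<alpha> \<in> carrier_mat (s + 1) (s + 1) \<and> \<beta> \<in> carrier_mat (s + 1) (s + 1) \<and>
     (\<forall>i\<le>s. \<alpha> $$ (i, s) = 0 \<and> \<beta> $$ (i, s) = 0) \<and>
     invertible_mat (1\<^sub>m s - lead_block s \<alpha>)"

definition explicit_method :: "nat \<Rightarrow> real mat \<Rightarrow> real mat \<Rightarrow> bool" where
  "explicit_method s \<alpha> \<beta> \<longleftrightarrow>
     (\<forall>i\<le>s. \<forall>j\<le>s. i \<le> j \<longrightarrow> \<alpha> $$ (i, j) = 0 \<and> \<beta> $$ (i, j) = 0)"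

definition so_v :: "nat \<Rightarrow> real mat \<Rightarrow> nat \<Rightarrow> real" where
  "so_v s \<alpha> i = 1 - (\<Sum>j\<le>s. \<alpha> $$ (i, j))"

definition abscissae :: "nat \<Rightarrow> real mat \<Rightarrow> real mat \<Rightarrow> real Matrix.vec" where
  "abscissae s \<alpha> \<beta> =
     inv_mat (1\<^sub>m s - lead_block s \<alpha>) *\<^sub>v (lead_block s \<beta> *\<^sub>v Matrix.vec s (\<lambda>_. 1))"

text \<open>
  One step from the value \<open>u\<close> at time \<open>t\<close> with residuals \<open>r 0, \<dots>, r s\<close>; the new value is \<open>Y s\<close>.
  The unperturbed method is the case \<open>r = (\<lambda>_. 0)\<close>.
\<close>

definition rk_step ::
  "nat \<Rightarrow> real mat \<Rightarrow> real mat \<Rightarrow> (real \<Rightarrow> 'a \<Rightarrow> 'a) \<Rightarrow> real \<Rightarrow> real \<Rightarrow> 'a \<Rightarrow>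
     (nat \<Rightarrow> 'a) \<Rightarrow> (nat \<Rightarrow> 'a::real_vector) \<Rightarrow> bool" where
  "rk_step s \<alpha> \<beta> F \<tau> t u r Y \<longleftrightarrow>
     (\<forall>i\<le>s. Y i = so_v s \<alpha> i *\<^sub>R u
        + (\<Sum>j<s. (\<alpha> $$ (i, j)) *\<^sub>R Y j
             + (\<tau> * \<beta> $$ (i, j)) *\<^sub>R F (t + vec_index (abscissae s \<alpha> \<beta>) j * \<tau>) (Y j))
        + r i)"

text \<open>
  On Euclidean spaces, \<open>Ck n f\<close> says that \<open>f\<close> is \<open>n\<close> times differentiable with continuous
  \<open>n\<close>-th derivatives, expressed through iterated directional derivatives.
\<close>

primrec Ck :: "nat \<Rightarrow> ('a::euclidean_space \<Rightarrow> 'b::euclidean_space) \<Rightarrow> bool" where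
  "Ck 0 f \<longleftrightarrow> continuous_on UNIV f"
| "Ck (Suc n) f \<longleftrightarrow>
     (\<forall>x. f differentiable (at x)) \<and> (\<forall>v. Ck n (\<lambda>x. frechet_derivative f (at x) v))"

definition smooth_fun :: "('a::euclidean_space \<Rightarrow> 'b::euclidean_space) \<Rightarrow> bool" where
  "smooth_fun f \<longleftrightarrow> (\<forall>n. Ck n f)"

text \<open>
  Order (at least) \<open>p\<close> for systems in the space \<open>'a\<close>: for every smooth right-hand side, one step
  started on an exact solution \<open>U\<close> has error \<open>O(\<tau>\<^sup>p\<^sup>+\<^sup>1)\<close>, uniformly on compact time intervals.
  The Lipschitz condition makes the stage equations, which may be implicit, uniquely solvable for
  small \<open>\<tau>\<close>. The order is a local notion, so restricting to such \<open>F\<close> does not change it.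
\<close>

definition rk_order ::
  "'a::euclidean_space itself \<Rightarrow> nat \<Rightarrow> real mat \<Rightarrow> real mat \<Rightarrow> nat \<Rightarrow> bool" where
  "rk_order (_::'a itself) s \<alpha> \<beta> p \<longleftrightarrow>
     (\<forall>(F :: real \<Rightarrow> 'a \<Rightarrow> 'a) U a b.
        smooth_fun (\<lambda>(t, u). F t u) \<and>
        (\<exists>K. \<forall>t u w. norm (F t u - F t w) \<le> K * norm (u - w)) \<and>
        (\<forall>t\<in>{a..b}. (U has_vector_derivative F t (U t)) (at t within {a..b})) \<longrightarrow>
        (\<exists>C \<tau>\<^sub>0. \<tau>\<^sub>0 > 0 \<and>
           (\<forall>\<tau> t Y. 0 < \<tau> \<and> \<tau> \<le> \<tau>\<^sub>0 \<and> a \<le> t \<and> t + \<tau> \<le> b \<and>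
              rk_step s \<alpha> \<beta> F \<tau> t (U t) (\<lambda>_. 0) Y \<longrightarrow>
              norm (Y s - U (t + \<tau>)) \<le> C * \<tau> ^ (p + 1))))"

definition stage_matrix :: "nat \<Rightarrow> real mat \<Rightarrow> real mat \<Rightarrow> complex \<Rightarrow> complex mat" where
  "stage_matrix s \<alpha> \<beta> z =
     1\<^sub>m s - map_mat of_real (lead_block s \<alpha>) - z \<cdot>\<^sub>m map_mat of_real (lead_block s \<beta>)"

definition final_row :: "nat \<Rightarrow> real mat \<Rightarrow> real mat \<Rightarrow> complex \<Rightarrow> complex Matrix.vec" where
  "final_row s \<alpha> \<beta> z =
     map_vec of_real (last_row s \<alpha>) + z \<cdot>\<^sub>v map_vec of_real (last_row s \<beta>)"

definition stability_fun :: "nat \<Rightarrow> real mat \<Rightarrow> real mat \<Rightarrow> complex \<Rightarrow> complex" where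
  "stability_fun s \<alpha> \<beta> z =
     of_real (so_v s \<alpha> s) +
     scalar_prod (final_row s \<alpha> \<beta> z)
       (inv_mat (stage_matrix s \<alpha> \<beta> z) *\<^sub>v Matrix.vec s (\<lambda>i. of_real (so_v s \<alpha> i)))"

text \<open>The product of a row vector with a matrix is written with the transposed matrix.\<close>

definition internal_stability_fun ::
  "nat \<Rightarrow> real mat \<Rightarrow> real mat \<Rightarrow> nat \<Rightarrow> complex \<Rightarrow> complex" where
  "internal_stability_fun s \<alpha> \<beta> j z =
     vec_index (transpose_mat (inv_mat (stage_matrix s \<alpha> \<beta> z)) *\<^sub>v final_row s \<alpha> \<beta> z) j"

text \<open>The stability function is only defined where the matrix to be inverted is invertible.\<close>

definition stability_region :: "nat \<Rightarrow> real mat \<Rightarrow> real mat \<Rightarrow> complex set" where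
  "stability_region s \<alpha> \<beta> =
     {z. invertible_mat (stage_matrix s \<alpha> \<beta> z) \<and> cmod (stability_fun s \<alpha> \<beta> z) \<le> 1}"

text \<open>
  The value may be \<open>\<infinity>\<close> when \<open>S\<close> is unbounded. The maximum is over the stages only. The residual of
  the final row enters the error with coefficient 1, which is not among the \<open>Q\<^sub>j\<close>. So the
  error bound with \<open>s + 1\<close> copies of this factor needs it to be at least 1: for forward Euler
  and \<open>S = {0}\<close> it is 0, although the final residual is passed on unchanged.
\<close>

definition max_internal_amplification ::
  "nat \<Rightarrow> real mat \<Rightarrow> real mat \<Rightarrow> complex set \<Rightarrow> ereal" where
  "max_internal_amplification s \<alpha> \<beta> S =
     (MAX j\<in>{..<s}. SUP z\<in>S. ereal (cmod (internal_stability_fun s \<alpha> \<beta> j z)))"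

definition normal_matrix :: "real ^ 'm ^ 'm \<Rightarrow> bool" where
  "normal_matrix L \<longleftrightarrow> L ** transpose L = transpose L ** L"

definition complex_spectrum :: "real ^ 'm ^ 'm \<Rightarrow> complex set" where
  "complex_spectrum L =
     {z. \<exists>x :: complex ^ 'm. x \<noteq> 0 \<and> map_matrix complex_of_real L *v x = z *s x}"

end

theory Submission
  imports Defs "HOL-Computational_Algebra.Fundamental_Theorem_Algebra"
begin

text \<open>
  The step is affine in the initial value, the values of \<open>g\<close> and the residuals. Let \<open>V\<close> be the stages of an
  unperturbed step started on the exact solution, at \<open>U t\<close>. Then \<open>Y s - U (t + \<tau>)\<close> is the sum of
  \<open>Y s - V s\<close> and of the local error \<open>V s - U (t + \<tau>)\<close>. The differences \<open>Y - V\<close> satisfy the stage equations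
  of the homogeneous problem \<open>U' = L U\<close> with initial value \<open>u - U t\<close> and residuals \<open>r\<close>.

  A normal matrix has an orthonormal basis of complex eigenvectors
  (\<open>normal_matrix_orthonormal_eigenbasis\<close>). In its coordinates the homogeneous stage equations split into
  scalar systems with \<open>z = \<tau> \<lambda>\<close>, one for each basis vector, and each of them has the solution
  \<open>y\<^sub>s = P(z) e + Q\<^sub>0(z) r\<^sub>0 + \<dots> + Q\<^sub>s\<^sub>-\<^sub>1(z) r\<^sub>s\<^sub>-\<^sub>1 + r\<^sub>s\<close> (\<open>stage_eqs_final\<close>). All these \<open>z\<close> lie in \<open>S\<close>, where
  \<open>|P(z)| \<le> 1\<close>, and Parseval's identity turns the estimates of the coordinates into the bound
  \<open>norm e + (\<Sum>j<s. K j * norm (r j)) + norm (r s)\<close> on \<open>Y s - V s\<close>, with \<open>K j\<close> the maximum of \<open>|Q\<^sub>j|\<close>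
  over \<open>\<tau>\<close> times the spectrum (\<open>linear_step_bound\<close>). The \<open>s\<close> stage terms and the final residual are each
  at most the amplification factor, which is at least 1, times the largest residual.

  The stages \<open>V\<close> exist because the scalar systems are solvable wherever the stability function is
  defined (\<open>linear_step_exists\<close>). For small \<open>\<tau>\<close> the order of the method bounds the local error by a multiple
  of \<open>\<tau>\<^sup>p\<^sup>+\<^sup>1\<close>. The remainder \<open>R\<close> has to be finite for large \<open>\<tau>\<close> as well; there, the local error is
  bounded by compactness of the time interval (\<open>local_error_bounded\<close>).
\<close>

text \<open>
  Components of \<open>real ^ 'm\<close> and \<open>complex ^ 'm\<close> are written with \<open>$\<close>, which would otherwise be
  ambiguous.
\<close>

no_notation Matrix.vec_index (infixl "$" 100)

no_notation Matrix.vec_index (infixl "$" 100)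

section \<open>Orthonormal eigenbases of normal complex matrices\<close>

text \<open>
  Conjugate-linear in the second argument, so that the coefficient of \<open>x\<close> at an orthonormal basis
  vector \<open>b\<close> is \<open>cinner x b\<close>.
\<close>

definition cinner :: "complex ^ 'm \<Rightarrow> complex ^ 'm \<Rightarrow> complex" where
  "cinner x y = (\<Sum>i\<in>UNIV. x $ i * cnj (y $ i))"

lemma cinner_add_left: "cinner (x + y) z = cinner x z + cinner y z"
  by (simp add: cinner_def algebra_simps sum.distrib)

lemma cinner_scale_left: "cinner (c *s x) z = c * cinner x z"
  by (simp add: cinner_def algebra_simps sum_distrib_left)

lemma cinner_diff_left: "cinner (x - y) z = cinner x z - cinner y z"
  by (simp add: cinner_def algebra_simps sum_subtractf)

lemma cinner_commute: "cinner x y = cnj (cinner y x)"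
  by (simp add: cinner_def mult.commute)

lemma cinner_zero_left [simp]: "cinner 0 z = 0"
  by (simp add: cinner_def)

lemma cinner_sum_left: "cinner (\<Sum>k\<in>A. f k) z = (\<Sum>k\<in>A. cinner (f k) z)"
  by (induction A rule: infinite_finite_induct) (simp_all add: cinner_add_left)

lemma cinner_scale_right: "cinner x (c *s z) = cnj c * cinner x z"
  by (simp add: cinner_def algebra_simps sum_distrib_left)

lemma cinner_diff_right: "cinner x (y - z) = cinner x y - cinner x z"
  by (simp add: cinner_def algebra_simps sum_subtractf)

lemma cinner_self: "cinner x x = of_real ((norm x)\<^sup>2)"
proof -
  have "(norm x)\<^sup>2 = (\<Sum>i\<in>UNIV. (cmod (x $ i))\<^sup>2)"
    by (simp add: norm_vec_def L2_set_def sum_nonneg)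
  then show ?thesis
    by (simp add: cinner_def complex_norm_square del: of_real_power)
qed

lemma cinner_self_eq_0 [simp]: "cinner x x = 0 \<longleftrightarrow> x = 0"
  by (simp add: cinner_self)

definition hermitian_adjoint :: "complex ^ 'm ^ 'm \<Rightarrow> complex ^ 'm ^ 'm" where
  "hermitian_adjoint A = (\<chi> i j. cnj (A $ j $ i))"

lemma cinner_hermitian_adjoint: "cinner (A *v x) y = cinner x (hermitian_adjoint A *v y)"
proof -
  have "cinner (A *v x) y = (\<Sum>i\<in>UNIV. \<Sum>j\<in>UNIV. A $ i $ j * x $ j * cnj (y $ i))"
    by (simp add: cinner_def matrix_vector_mult_def sum_distrib_right)
  also have "\<dots> = (\<Sum>j\<in>UNIV. \<Sum>i\<in>UNIV. A $ i $ j * x $ j * cnj (y $ i))"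
    by (rule sum.swap)
  also have "\<dots> = cinner x (hermitian_adjoint A *v y)"
    by (simp add: cinner_def matrix_vector_mult_def hermitian_adjoint_def sum_distrib_left algebra_simps)
  finally show ?thesis .
qed

lemma hermitian_adjoint_hermitian_adjoint [simp]: "hermitian_adjoint (hermitian_adjoint A) = A"
  by (simp add: hermitian_adjoint_def Finite_Cartesian_Product.vec_eq_iff)

text \<open>
  For a normal matrix \<open>N\<close>, the vectors \<open>N x\<close> and \<open>N\<^sup>* x\<close> have the same norm. With \<open>N = A - l I\<close>, which
  is normal if \<open>A\<close> is, the kernel of \<open>N\<close> is therefore the kernel of \<open>N\<^sup>*\<close>.
\<close>

lemma normal_eigenvector_adjoint:
  assumes N: "A ** hermitian_adjoint A = hermitian_adjoint A ** A" and ev: "A *v x = l *s x"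
  shows "hermitian_adjoint A *v x = cnj l *s x"
proof -
  let ?H = "hermitian_adjoint A"
  have 1: "cinner (?H *v x) (?H *v x) = cinner (A *v x) (A *v x)"
    using N by (simp add: cinner_hermitian_adjoint matrix_vector_mul_assoc)
  have "cinner (?H *v x - cnj l *s x) (?H *v x - cnj l *s x) = 
     cinner (A *v x) (A *v x) - l * cinner x (A *v x) - cnj l * cinner (A *v x) x + l * cnj l * cinner x x"
    using 1 by (simp add: cinner_diff_left cinner_diff_right cinner_scale_left cinner_scale_right
       cinner_hermitian_adjoint algebra_simps)
  also have "\<dots> = 0"
    by (simp add: ev cinner_scale_left cinner_scale_right)
  finally show ?thesis by simp
qed

text \<open>
  The vector \<open>q(A) x\<close>, by Horner's scheme.
\<close>

definition poly_mat_vec :: "complex poly \<Rightarrow> complex ^ 'm ^ 'm \<Rightarrow> complex ^ 'm \<Rightarrow> complex ^ 'm" where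
  "poly_mat_vec q A x = fold_coeffs (\<lambda>a v. a *s x + A *v v) q 0"

lemma poly_mat_vec_0 [simp]: "poly_mat_vec 0 A x = 0"
  by (simp add: poly_mat_vec_def)

lemma poly_mat_vec_pCons [simp]: "poly_mat_vec (pCons a q) A x = a *s x + A *v poly_mat_vec q A x"
  by (cases "q = 0"; cases "a = 0") (simp_all add: poly_mat_vec_def)

lemma poly_mat_vec_add: "poly_mat_vec (p + q) A x = poly_mat_vec p A x + poly_mat_vec q A x"
  by (induction p q rule: poly_induct2)
     (simp_all add: vec.scale_left_distrib matrix_vector_right_distrib algebra_simps)

lemma poly_mat_vec_smult: "poly_mat_vec (Polynomial.smult c q) A x = c *s poly_mat_vec q A x"
  by (induction q)
     (simp_all add: vec.scale_right_distrib vector_smult_assoc vec.scale)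

lemma poly_mat_vec_linear_factor:
  "poly_mat_vec ([:- l, 1:] * q) A x = A *v poly_mat_vec q A x - l *s poly_mat_vec q A x"
proof -
  have "[:- l, 1:] * q = Polynomial.smult (- l) q + pCons 0 q" by simp
  then show ?thesis
    by (simp only: poly_mat_vec_add poly_mat_vec_smult poly_mat_vec_pCons) simp
qed

lemma poly_mat_vec_monom: "poly_mat_vec (Polynomial.monom c n) A x = c *s (((*v) A ^^ n) x)"
  by (induction n) (simp_all add: monom_0 monom_Suc vec.scale)

lemma poly_mat_vec_sum: "poly_mat_vec (\<Sum>k\<in>K. f k) A x = (\<Sum>k\<in>K. poly_mat_vec (f k) A x)"
  by (induction K rule: infinite_finite_induct) (simp_all add: poly_mat_vec_add)

text \<open>
  A dimension count: the \<open>n + 1\<close> vectors \<open>x, A x, \<dots>, A\<^sup>n x\<close> of an \<open>n\<close>-dimensional space satisfy a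
  nontrivial linear relation, and its coefficients are those of \<open>q\<close>. If two of the vectors coincide
  they form a smaller set, for which the count fails, but then the relation is their difference.
\<close>

lemma annihilating_polynomial:
  fixes A :: "complex ^ 'm ^ 'm"
  obtains q where "q \<noteq> 0" and "poly_mat_vec q A x = 0"
proof -
  let ?n = "CARD('m)" and ?f = "\<lambda>i. ((*v) A ^^ i) x"
  show thesis
  proof (cases "inj_on ?f {..?n}")
    case False
    then obtain i j where ij: "i \<noteq> j" "?f i = ?f j" by (auto simp: inj_on_def)
    let ?q = "Polynomial.monom 1 i + Polynomial.monom (-1) j :: complex poly"
    have "coeff ?q i = 1" using ij by simp
    then have "?q \<noteq> 0" by (metis coeff_0 zero_neq_one)
    moreover have "poly_mat_vec ?q A x = 0"
      using ij by (simp add: poly_mat_vec_add poly_mat_vec_monom)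
    ultimately show thesis by (rule that)
  next
    case True
    then have "card (?f ` {..?n}) = ?n + 1" by (simp add: card_image)
    then have "vec.dependent (?f ` {..?n})"
      using vec.independent_bound_general[of "?f ` {..?n}"] dim_subset_UNIV_cart_gen[of "?f ` {..?n}"]
      by auto
    then obtain u v where v: "v \<in> ?f ` {..?n}" "u v \<noteq> 0"
      and s: "(\<Sum>v\<in>?f ` {..?n}. u v *s v) = 0"
      by (auto simp: vec.dependent_finite)
    let ?q = "\<Sum>i\<le>?n. Polynomial.monom (u (?f i)) i"
    obtain i where i: "i \<le> ?n" "v = ?f i" using v by auto
    have "coeff ?q i = u (?f i)" using i by (simp add: coeff_sum)
    then have "?q \<noteq> 0" using v i by (metis coeff_0)
    moreover have "poly_mat_vec ?q A x = 0"
      using s by (simp add: poly_mat_vec_sum poly_mat_vec_monom sum.reindex[OF True])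
    ultimately show thesis by (rule that)
  qed
qed

text \<open>
  Take an annihilating polynomial \<open>q\<close> of \<open>x\<close> of least degree and split off a linear factor,
  \<open>q = (X - l) q'\<close>. By minimality \<open>q'(A) x\<close> is nonzero, it lies in \<open>W\<close> because \<open>W\<close> is invariant, and
  \<open>A - l I\<close> maps it to \<open>q(A) x = 0\<close>. This form avoids having to restrict \<open>A\<close> to \<open>W\<close>.
\<close>

lemma eigenvector_in_invariant_subspace:
  fixes A :: "complex ^ 'm ^ 'm"
  assumes W: "vec.subspace W" and inv: "\<And>y. y \<in> W \<Longrightarrow> A *v y \<in> W"
    and x: "x \<in> W" "x \<noteq> 0"
  obtains y l where "y \<in> W" "y \<noteq> 0" "A *v y = l *s y"
proof -
  define ann where "ann q \<longleftrightarrow> q \<noteq> 0 \<and> poly_mat_vec q A x = 0" for q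
  have "\<exists>q. ann q" using annihilating_polynomial[of A x] unfolding ann_def by blast
  then obtain q where q: "ann q" and least: "\<And>q'. ann q' \<Longrightarrow> degree q \<le> degree q'"
    using ex_has_least_nat[of ann _ degree] by blast
  have "\<not> (\<exists>a r. a \<noteq> 0 \<and> r = 0 \<and> q = pCons a r)"
    using q x by (auto simp: ann_def)
  then obtain l where "poly q l = 0" using fundamental_theorem_of_algebra_alt by blast
  then obtain q' where q': "q = [:- l, 1:] * q'" by (auto simp: poly_eq_0_iff_dvd)
  have nz: "q' \<noteq> 0" using q q' by (auto simp: ann_def)
  have "degree q = 1 + degree q'" unfolding q' using nz by (subst degree_mult_eq) auto
  then have "\<not> ann q'" using least[of q'] by auto
  then have "poly_mat_vec q' A x \<noteq> 0" using nz by (simp add: ann_def)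
  moreover have "poly_mat_vec r A x \<in> W" for r
    by (induction r) (auto simp: vec.subspace_0[OF W] x inv
        intro!: vec.subspace_add[OF W] vec.subspace_scale[OF W])
  moreover have "A *v poly_mat_vec q' A x = l *s poly_mat_vec q' A x"
    using q unfolding ann_def q' poly_mat_vec_linear_factor by simp
  ultimately show thesis using that by blast
qed

definition orthonormal_eigenvectors :: "complex ^ 'm ^ 'm \<Rightarrow> (complex ^ 'm) set \<Rightarrow> bool" where
  "orthonormal_eigenvectors A B \<longleftrightarrow>
     (\<forall>b\<in>B. \<forall>b'\<in>B. cinner b b' = (if b = b' then 1 else 0)) \<and> (\<forall>b\<in>B. \<exists>l. A *v b = l *s b)"

text \<open>
  Orthonormal vectors are linearly independent, so orthonormal systems of eigenvectors have bounded
  size and one of maximal size exists.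
\<close>

lemma orthonormal_eigenvectors_card:
  fixes A :: "complex ^ 'm ^ 'm"
  assumes "orthonormal_eigenvectors A B"
  shows "finite B \<and> card B \<le> CARD('m)"
proof -
  have "vec.independent B"
    unfolding vec.dependent_explicit
  proof safe
    fix T u v assume T: "finite T" "T \<subseteq> B" "(\<Sum>v\<in>T. u v *s v) = 0" "v \<in> T" "u v \<noteq> 0"
    have "0 = cinner (\<Sum>v\<in>T. u v *s v) v" using T by simp
    also have "\<dots> = (\<Sum>w\<in>T. if w = v then u w else 0)"
      unfolding cinner_sum_left cinner_scale_left
      using T assms by (intro sum.cong) (auto simp: orthonormal_eigenvectors_def subset_iff)
    also have "\<dots> = u v" using T by simp
    finally show False using T by simp
  qed
  then show ?thesis
    using vec.independent_bound_general[of B] dim_subset_UNIV_cart_gen[of B] by linarith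
qed

text \<open>
  Let \<open>B\<close> be an orthonormal system of eigenvectors of maximal size. Its elements are also
  eigenvectors of the adjoint, so the orthogonal complement \<open>W\<close> of \<open>B\<close> is invariant under \<open>A\<close>. If \<open>W\<close>
  were not zero, it would contain an eigenvector, which after normalization would enlarge \<open>B\<close>. Hence
  \<open>W\<close> is zero, and every vector equals its orthogonal projection onto the span of \<open>B\<close>.
\<close>

theorem normal_matrix_orthonormal_eigenbasis:
  fixes A :: "complex ^ 'm ^ 'm"
  assumes N: "A ** hermitian_adjoint A = hermitian_adjoint A ** A"
  obtains B where "finite B" "orthonormal_eigenvectors A B"
    and "\<And>x. x = (\<Sum>b\<in>B. cinner x b *s b)"
proof -
  have "orthonormal_eigenvectors A {}" by (simp add: orthonormal_eigenvectors_def)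
  then have "\<exists>B. orthonormal_eigenvectors A B \<and>
      (\<forall>B'. orthonormal_eigenvectors A B' \<longrightarrow> card B' \<le> card B)"
    using orthonormal_eigenvectors_card[of A]
    by (intro ex_has_greatest_nat[of _ "{}" _ "CARD('m) + 1"]) (auto simp: less_Suc_eq_le)
  then obtain B where B: "orthonormal_eigenvectors A B"
    and greatest: "\<And>B'. orthonormal_eigenvectors A B' \<Longrightarrow> card B' \<le> card B"
    by blast
  have fin: "finite B" using orthonormal_eigenvectors_card[OF B] by simp
  define W where "W = {x. \<forall>b\<in>B. cinner x b = 0}"
  have W: "vec.subspace W"
    by (auto simp: vec.subspace_def W_def cinner_add_left cinner_scale_left)
  have inv: "A *v y \<in> W" if "y \<in> W" for y
    unfolding W_def
  proof safe
    fix b assume b: "b \<in> B"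
    then obtain l where "A *v b = l *s b" using B unfolding orthonormal_eigenvectors_def by blast
    then have "hermitian_adjoint A *v b = cnj l *s b" by (rule normal_eigenvector_adjoint[OF N])
    then show "cinner (A *v y) b = 0"
      using that b by (simp add: cinner_hermitian_adjoint cinner_scale_right W_def)
  qed
  have W0: "x = 0" if "x \<in> W" for x
  proof (rule ccontr)
    assume "x \<noteq> 0"
    then obtain y l where y: "y \<in> W" "y \<noteq> 0" "A *v y = l *s y"
      using eigenvector_in_invariant_subspace[OF W inv \<open>x \<in> W\<close>] by blast
    define w where "w = complex_of_real (1 / norm y) *s y"
    have w1: "cinner w w = 1"
    proof -
    let ?c = "complex_of_real (1 / norm y)"
    have "cinner w w = cnj ?c * (?c * cinner y y)"
      by (simp only: w_def cinner_scale_left cinner_scale_right)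
    then show ?thesis using y by (simp add: cinner_self power2_eq_square)
  qed
    have w0: "cinner w b = 0" "cinner b w = 0" if "b \<in> B" for b
      using y that by (auto simp: w_def W_def cinner_scale_left cinner_scale_right cinner_commute[of b])
    have "A *v w = l *s w"
      using y by (simp add: w_def vec.scale mult.commute)
    then have "orthonormal_eigenvectors A (insert w B)"
      using B w1 w0 by (auto simp: orthonormal_eigenvectors_def)
    moreover have "w \<notin> B" using w0[of w] w1 by auto
    ultimately show False using greatest[of "insert w B"] fin by simp
  qed
  have "x = (\<Sum>b\<in>B. cinner x b *s b)" for x
  proof -
    have "cinner (\<Sum>b\<in>B. cinner x b *s b) b' = cinner x b'" if "b' \<in> B" for b'
    proof -
      have "cinner (\<Sum>b\<in>B. cinner x b *s b) b' = (\<Sum>b\<in>B. if b = b' then cinner x b else 0)"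
        unfolding cinner_sum_left cinner_scale_left
        using B that by (intro sum.cong) (auto simp: orthonormal_eigenvectors_def)
      then show ?thesis using that fin by simp
    qed
    then have "x - (\<Sum>b\<in>B. cinner x b *s b) \<in> W" by (simp add: W_def cinner_diff_left)
    from W0[OF this] show ?thesis by simp
  qed
  with fin B show thesis using that by blast
qed

section \<open>The stage equations of a scalar linear problem\<close>

lemma inv_mat_inverse:
  fixes A :: "'a::field mat"
  assumes A: "A \<in> carrier_mat n n" and inv: "invertible_mat A"
  shows "inv_mat A \<in> carrier_mat n n" "A * inv_mat A = 1\<^sub>m n" "inv_mat A * A = 1\<^sub>m n"
proof -
  obtain B where AB: "A * B = 1\<^sub>m (dim_row A)" and BA: "B * A = 1\<^sub>m (dim_row B)"
    using inv unfolding invertible_mat_def inverts_mat_def by blast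
  have "dim_col (A * B) = n" "dim_col (B * A) = dim_row B"
    unfolding AB BA using A by auto
  then have B: "B \<in> carrier_mat n n" using A by auto
  then have "A \<in> Units (ring_mat TYPE('a) n ())"
    using A AB BA by (auto simp: Units_def ring_mat_def)
  then obtain C where "mat_inverse A = Some C" using mat_inverse(1)[OF A, where b = "()"] by (cases "mat_inverse A") auto
  with mat_inverse(2)[OF A this]
  show "inv_mat A \<in> carrier_mat n n" "A * inv_mat A = 1\<^sub>m n" "inv_mat A * A = 1\<^sub>m n"
    by (auto simp: inv_mat_def)
qed

text \<open>
  The stage equations for the scalar test equation with \<open>z = \<tau> \<lambda>\<close>, restricted to the rows in \<open>I\<close>. The
  rows \<open>{..<s}\<close> determine the stages; the row \<open>s\<close> then gives the new value.
\<close>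

definition stage_eqs ::
  "nat \<Rightarrow> real mat \<Rightarrow> real mat \<Rightarrow> complex \<Rightarrow> complex \<Rightarrow>
     (nat \<Rightarrow> complex) \<Rightarrow> nat set \<Rightarrow> (nat \<Rightarrow> complex) \<Rightarrow> bool" where
  "stage_eqs s \<alpha> \<beta> z e r I y \<longleftrightarrow> (\<forall>i\<in>I. y i = of_real (so_v s \<alpha> i) * e
     + (\<Sum>j<s. (of_real (\<alpha> $$ (i, j)) + z * of_real (\<beta> $$ (i, j))) * y j) + r i)"

lemma stage_matrix_carrier: "stage_matrix s \<alpha> \<beta> z \<in> carrier_mat s s"
  by (rule carrier_matI) (simp_all add: stage_matrix_def lead_block_def)

lemma stage_matrix_mult:
  assumes "i < s"
  shows "vec_index (stage_matrix s \<alpha> \<beta> z *\<^sub>v Matrix.vec s y) i =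
    y i - (\<Sum>j<s. (of_real (\<alpha> $$ (i, j)) + z * of_real (\<beta> $$ (i, j))) * y j)"
proof -
  have "vec_index (stage_matrix s \<alpha> \<beta> z *\<^sub>v Matrix.vec s y) i =
     (\<Sum>j<s. stage_matrix s \<alpha> \<beta> z $$ (i, j) * y j)"
    using assms carrier_matD[OF stage_matrix_carrier[of s \<alpha> \<beta> z]]
    by (simp add: scalar_prod_def lessThan_atLeast0)
  also have "\<dots> = (\<Sum>j<s. (if i = j then y j else 0) -
      (of_real (\<alpha> $$ (i, j)) + z * of_real (\<beta> $$ (i, j))) * y j)"
    using assms by (intro sum.cong) (auto simp: stage_matrix_def lead_block_def algebra_simps)
  finally show ?thesis using assms by (simp add: sum_subtractf)
qed

lemma stage_eqs_iff:
  "stage_eqs s \<alpha> \<beta> z e r {..<s} y \<longleftrightarrow>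
   stage_matrix s \<alpha> \<beta> z *\<^sub>v Matrix.vec s y =
     Matrix.vec s (\<lambda>i. of_real (so_v s \<alpha> i)  * e + r i)"
  unfolding stage_eqs_def Matrix.vec_eq_iff
  using carrier_matD[OF stage_matrix_carrier[of s \<alpha> \<beta> z]]
  by (auto simp: stage_matrix_mult algebra_simps simp del: index_mult_mat_vec)

lemma stage_eqs_solvable:
  assumes inv: "invertible_mat (stage_matrix s \<alpha> \<beta> z)"
  shows "\<exists>y. stage_eqs s \<alpha> \<beta> z e r {..<s} y"
proof -
  note M = stage_matrix_carrier[of s \<alpha> \<beta> z]
  note N = inv_mat_inverse[OF M inv]
  define w where "w = Matrix.vec s (\<lambda>i. of_real (so_v s \<alpha> i) * e + r i)"
  define y where "y = vec_index (inv_mat (stage_matrix s \<alpha> \<beta> z) *\<^sub>v w)"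
  have w: "w \<in> carrier_vec s" by (simp add: w_def)
  have "Matrix.vec s y = inv_mat (stage_matrix s \<alpha> \<beta> z) *\<^sub>v w"
    using N(1) by (auto simp: y_def Matrix.vec_eq_iff)
  then have "stage_matrix s \<alpha> \<beta> z *\<^sub>v Matrix.vec s y = w"
    using assoc_mult_mat_vec[OF M N(1) w] N(2) w by simp
  then show ?thesis by (auto simp: stage_eqs_iff w_def)
qed

text \<open>
  The stages are \<open>y = M\<^sup>-\<^sup>1 (e v + r)\<close> for the stage matrix \<open>M\<close>. Substituting them into the final row
  produces the factor \<open>P(z)\<close> at the initial value \<open>e\<close>, the factors \<open>Q\<^sub>j(z)\<close> at the residuals of the
  stages, and the residual of the final row itself, with factor 1.
\<close>

lemma stage_eqs_final:
  assumes inv: "invertible_mat (stage_matrix s \<alpha> \<beta> z)"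
    and y: "stage_eqs s \<alpha> \<beta> z e r {..s} y"
  shows "y s = stability_fun s \<alpha> \<beta> z * e
    + (\<Sum>j<s. internal_stability_fun s \<alpha> \<beta> j z * r j) + r s"
proof -
  note M = stage_matrix_carrier[of s \<alpha> \<beta> z]
  note N = inv_mat_inverse[OF M inv]
  let ?M = "stage_matrix s \<alpha> \<beta> z" and ?N = "inv_mat (stage_matrix s \<alpha> \<beta> z)"
  let ?f = "final_row s \<alpha> \<beta> z" and ?Y = "Matrix.vec s y"
  let ?v = "Matrix.vec s (\<lambda>i. complex_of_real (so_v s \<alpha> i))" and ?r = "Matrix.vec s r"
  have f: "?f \<in> carrier_vec s" by (simp add: final_row_def last_row_def)
  have c: "?v \<in> carrier_vec s" "?r \<in> carrier_vec s" "e \<cdot>\<^sub>v ?v \<in> carrier_vec s" 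
    "?N *\<^sub>v ?v \<in> carrier_vec s" "?N *\<^sub>v ?r \<in> carrier_vec s" "e \<cdot>\<^sub>v (?N *\<^sub>v ?v) \<in> carrier_vec s"
    using N(1) by auto
  have "?M *\<^sub>v ?Y = e \<cdot>\<^sub>v ?v + ?r"
    using y stage_eqs_iff[of s \<alpha> \<beta> z e r y] by (auto simp: stage_eqs_def)
  then have "?N *\<^sub>v (?M *\<^sub>v ?Y) = e \<cdot>\<^sub>v (?N *\<^sub>v ?v) + ?N *\<^sub>v ?r"
    by (simp only: mult_add_distrib_mat_vec[OF N(1) c(3) c(2)] mult_mat_vec[OF N(1) c(1)])
  moreover have "?N *\<^sub>v (?M *\<^sub>v ?Y) = ?Y"
    using assoc_mult_mat_vec[OF N(1) M, of ?Y] one_mult_mat_vec[of ?Y s] unfolding N(3) by simp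
  ultimately have Y: "?Y = e \<cdot>\<^sub>v (?N *\<^sub>v ?v) + ?N *\<^sub>v ?r" by simp
  have "y s = of_real (so_v s \<alpha> s) * e + scalar_prod ?f ?Y + r s"
    using bspec[OF y[unfolded stage_eqs_def], of s] by (simp add: scalar_prod_def final_row_def last_row_def lessThan_atLeast0 algebra_simps)
  also have "scalar_prod ?f ?Y = e * scalar_prod ?f (?N *\<^sub>v ?v) + scalar_prod ?f (?N *\<^sub>v ?r)"
    unfolding Y using f c by (simp add: scalar_prod_add_distrib)
  also have "scalar_prod ?f (?N *\<^sub>v ?r) = scalar_prod (transpose_mat ?N *\<^sub>v ?f) ?r"
    by (rule transpose_vec_mult_scalar[symmetric, OF N(1) c(2) f])
  also have "\<dots> = (\<Sum>j<s. internal_stability_fun s \<alpha> \<beta> j z * r j)"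
    by (simp add: scalar_prod_def internal_stability_fun_def lessThan_atLeast0)
  finally show ?thesis by (simp add: stability_fun_def algebra_simps)
qed

section \<open>Real normal matrices in complex eigencoordinates\<close>

definition complex_vec :: "real ^ 'm \<Rightarrow> complex ^ 'm" where
  "complex_vec x = (\<chi> i. complex_of_real (x $ i))"

lemma norm_complex_vec [simp]: "norm (complex_vec x) = norm x"
  by (simp add: norm_vec_def complex_vec_def)

lemma complex_vec_add: "complex_vec (x + y) = complex_vec x + complex_vec y"
  by (simp add: complex_vec_def Finite_Cartesian_Product.vec_eq_iff)

lemma complex_vec_scaleR: "complex_vec (c *\<^sub>R x) = of_real c *s complex_vec x"
  by (simp add: complex_vec_def Finite_Cartesian_Product.vec_eq_iff)

lemma complex_vec_sum: "complex_vec (\<Sum>k\<in>A. f k) = (\<Sum>k\<in>A. complex_vec (f k))"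
  by (induction A rule: infinite_finite_induct)
     (simp_all add: complex_vec_add, simp_all add: complex_vec_def Finite_Cartesian_Product.vec_eq_iff)

lemma complex_vec_mult: "complex_vec (L *v x) = map_matrix complex_of_real L *v complex_vec x"
  by (simp add: complex_vec_def Finite_Cartesian_Product.vec_eq_iff matrix_vector_mult_def map_matrix_def)

lemma normal_matrix_complex:
  fixes L :: "real ^ 'm ^ 'm"
  assumes "normal_matrix L"
  defines "A \<equiv> map_matrix complex_of_real L"
  shows "A ** hermitian_adjoint A = hermitian_adjoint A ** A"
proof -
  have H: "hermitian_adjoint A = map_matrix complex_of_real (transpose L)"
    by (simp add: A_def hermitian_adjoint_def map_matrix_def transpose_def Finite_Cartesian_Product.vec_eq_iff)
  have m: "map_matrix complex_of_real (P ** Q) = map_matrix complex_of_real P ** map_matrix complex_of_real Q"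
    for P Q :: "real ^ 'm ^ 'm"
    by (simp add: map_matrix_def matrix_matrix_mult_def Finite_Cartesian_Product.vec_eq_iff)
  show ?thesis 
    unfolding H unfolding A_def m[symmetric] using assms(1) by (simp add: normal_matrix_def)
qed

text \<open>
  \<open>B\<close> is an eigenbasis with eigenvalues \<open>l\<close> in which \<open>x\<close> has the coefficients \<open>cinner x b\<close>, and the
  matrix acts on each of these coefficients by multiplication with the eigenvalue. The last part is where
  normality enters; it is what decouples the stage equations.
\<close>

definition eigenbasis :: "real ^ 'm ^ 'm \<Rightarrow> (complex ^ 'm) set \<Rightarrow> (complex ^ 'm \<Rightarrow> complex) \<Rightarrow> bool" where
  "eigenbasis L B l \<longleftrightarrow> finite B \<and> (\<forall>x. x = (\<Sum>b\<in>B. cinner x b *s b)) \<and>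
     (\<forall>b\<in>B. b \<noteq> 0 \<and> map_matrix complex_of_real L *v b = l b *s b \<and>
       (\<forall>x. cinner (map_matrix complex_of_real L *v x) b = l b * cinner x b))"

lemma normal_matrix_eigenbasis:
  fixes L :: "real ^ 'm ^ 'm"
  assumes "normal_matrix L"
  obtains B l where "eigenbasis L B l"
proof -
  let ?A = "map_matrix complex_of_real L"
  note N = normal_matrix_complex[OF assms]
  obtain B where B: "finite B" "orthonormal_eigenvectors ?A B"
    and ex: "\<And>x. x = (\<Sum>b\<in>B. cinner x b *s b)"
    using normal_matrix_orthonormal_eigenbasis[OF N] by blast
  from B(2) have "\<forall>b\<in>B. \<exists>l. ?A *v b = l *s b" by (simp add: orthonormal_eigenvectors_def)
  then obtain l where l: "\<And>b. b \<in> B \<Longrightarrow> ?A *v b = l b *s b" by metis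
  have "cinner (?A *v x) b = l b * cinner x b" if "b \<in> B" for x b
    by (simp add: cinner_hermitian_adjoint normal_eigenvector_adjoint[OF N l[OF that]] cinner_scale_right)
  moreover have "b \<noteq> 0" if "b \<in> B" for b
    using B(2) that by (fastforce simp: orthonormal_eigenvectors_def)
  ultimately have "eigenbasis L B l" using B(1) ex l by (auto simp: eigenbasis_def)
  then show thesis by (rule that)
qed

text \<open>
  The expansion (second fact) loops as a rewrite rule, since its right-hand side contains \<open>x\<close> again; hence
  the separate facts.
\<close>

lemma eigenbasisD:
  assumes "eigenbasis L B l"
  shows "finite B" "x = (\<Sum>b\<in>B. cinner x b *s b)"
    and "b \<in> B \<Longrightarrow> b \<noteq> 0"
    and "b \<in> B \<Longrightarrow> map_matrix complex_of_real L *v b = l b *s b"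
    and "b \<in> B \<Longrightarrow> cinner (map_matrix complex_of_real L *v x) b = l b * cinner x b"
  using assms unfolding eigenbasis_def by blast+

lemma eigenbasis_spectrum:
  assumes "eigenbasis L B l"
  shows "complex_spectrum L = l ` B"
proof safe
  let ?A = "map_matrix complex_of_real L"
  fix z assume "z \<in> complex_spectrum L"
  then obtain x where x: "x \<noteq> 0" "?A *v x = z *s x" by (auto simp: complex_spectrum_def)
  have "x = (\<Sum>b\<in>B. cinner x b *s b)" by (rule eigenbasisD(2)[OF assms])
  have "\<exists>b\<in>B. cinner x b \<noteq> 0"
  proof (rule ccontr)
    assume "\<not> ?thesis"
    then have "(\<Sum>b\<in>B. cinner x b *s b) = 0" by simp
    then show False using \<open>x = _\<close> x(1) by simp
  qed
  then obtain b where b: "b \<in> B" "cinner x b \<noteq> 0" by blast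
  have "z * cinner x b = l b * cinner x b"
    using eigenbasisD(5)[OF assms b(1), of x] by (simp add: x(2) cinner_scale_left)
  then show "z \<in> l ` B" using b by auto
next
  fix b assume "b \<in> B"
  then show "l b \<in> complex_spectrum L"
    using eigenbasisD(3,4)[OF assms] by (auto simp: complex_spectrum_def)
qed

lemma eigenbasis_norm:
  assumes "eigenbasis L B l"
  shows "norm x = L2_set (\<lambda>b. cmod (cinner x b)) B"
proof -
  have "x = (\<Sum>b\<in>B. cinner x b *s b)" by (rule eigenbasisD(2)[OF assms])
  then have "cinner x x = (\<Sum>b\<in>B. cinner x b * cinner b x)"
    by (metis (no_types, lifting) cinner_scale_left cinner_sum_left sum.cong)
  also have "\<dots> = (\<Sum>b\<in>B. of_real ((cmod (cinner x b))\<^sup>2))"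
    by (intro sum.cong refl) (metis cinner_commute complex_norm_square)
  finally have "(norm x)\<^sup>2 = (\<Sum>b\<in>B. (cmod (cinner x b))\<^sup>2)"
    unfolding cinner_self of_real_sum[symmetric] of_real_eq_iff .
  then show ?thesis by (simp add: L2_set_def real_sqrt_unique)
qed

lemma spectrum_finite_nonempty:
  fixes L :: "real ^ 'm ^ 'm"
  assumes "normal_matrix L"
  shows "finite (complex_spectrum L)" and "complex_spectrum L \<noteq> {}"
proof -
  obtain B l where B: "eigenbasis L B l" using normal_matrix_eigenbasis[OF assms] .
  have "B \<noteq> {}"
  proof
    assume "B = {}"
    then have "norm (1 :: complex ^ 'm) = 0" by (simp add: eigenbasis_norm[OF B])
    then show False by (simp add: Finite_Cartesian_Product.vec_eq_iff)
  qed
  then show "finite (complex_spectrum L)" "complex_spectrum L \<noteq> {}"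
    using eigenbasisD(1)[OF B] by (simp_all add: eigenbasis_spectrum[OF B])
qed

section \<open>One step of the method for the homogeneous linear problem\<close>

lemma rk_step_stage_eqs:
  assumes B: "eigenbasis L B l" "b \<in> B"
    and step: "rk_step s \<alpha> \<beta> (\<lambda>_ x. L *v x) \<tau> t e r E"
  shows "stage_eqs s \<alpha> \<beta> (of_real \<tau> * l b) (cinner (complex_vec e) b)
    (\<lambda>i. cinner (complex_vec (r i)) b) {..s} (\<lambda>i. cinner (complex_vec (E i)) b)"
  unfolding stage_eqs_def
proof
  fix i assume "i \<in> {..s}"
  then have "i \<le> s" by simp
  with step have "E i = so_v s \<alpha> i *\<^sub>R e
        + (\<Sum>j<s. (\<alpha> $$ (i, j)) *\<^sub>R E j + (\<tau> * \<beta> $$ (i, j)) *\<^sub>R (L *v E j)) + r i"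
    unfolding rk_step_def by blast
  from arg_cong[OF this, of "\<lambda>x. cinner (complex_vec x) b"]
  show "cinner (complex_vec (E i)) b = of_real (so_v s \<alpha> i) * cinner (complex_vec e) b
     + (\<Sum>j<s. (of_real (\<alpha> $$ (i, j)) + of_real \<tau> * l b * of_real (\<beta> $$ (i, j))) * cinner (complex_vec (E j)) b)
     + cinner (complex_vec (r i)) b"
    by (simp add: complex_vec_add complex_vec_scaleR complex_vec_sum complex_vec_mult
       cinner_add_left cinner_scale_left cinner_sum_left eigenbasisD(5)[OF B] algebra_simps)
qed

lemma L2_set_sum_le: "L2_set (\<lambda>b. \<Sum>j\<in>J. f j b) B \<le> (\<Sum>j\<in>J. L2_set (f j) B)"
proof (induction J rule: infinite_finite_induct)
  case (insert j J)
  then show ?case using L2_set_triangle_ineq[of "f j" "\<lambda>b. \<Sum>j\<in>J. f j b" B] by simp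
qed (auto simp: L2_set_0')

text \<open>
  In eigencoordinates the step decouples into scalar problems. There the coefficient of \<open>E s\<close> is
  bounded, by stability and by the bounds \<open>K j\<close>, in terms of the coefficients of \<open>e\<close> and of the
  residuals. The \<open>K j\<close> do not depend on the eigenvalue, so Minkowski's inequality for the
  \<open>L\<^sup>2\<close> norm over the eigenbasis turns these bounds into a bound on norms.
\<close>

theorem linear_step_bound:
  fixes L :: "real ^ 'm ^ 'm"
  assumes normal: "normal_matrix L"
    and stable: "(\<lambda>z. of_real \<tau> * z) ` complex_spectrum L \<subseteq> stability_region s \<alpha> \<beta>"
    and K: "\<And>j z. j < s \<Longrightarrow> z \<in> complex_spectrum L \<Longrightarrow>
      cmod (internal_stability_fun s \<alpha> \<beta> j (of_real \<tau> * z)) \<le> K j"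
    and step: "rk_step s \<alpha> \<beta> (\<lambda>_ x. L *v x) \<tau> t e r E"
  shows "norm (E s) \<le> norm e + (\<Sum>j<s. K j * norm (r j)) + norm (r s)"
proof -
  obtain B l where B: "eigenbasis L B l" using normal_matrix_eigenbasis[OF normal] .
  let ?c = "\<lambda>x b. cmod (cinner (complex_vec x) b)"
  have n: "norm x = L2_set (?c x) B" for x :: "real ^ 'm"
    using eigenbasis_norm[OF B, of "complex_vec x"] by simp
  obtain z where z: "z \<in> complex_spectrum L"
    using spectrum_finite_nonempty(2)[OF normal] by blast
  have K0: "0 \<le> K j" if "j < s" for j
    using K[OF that z] norm_ge_zero order_trans by blast
  have c: "?c (E s) b \<le> ?c e b + ((\<Sum>j<s. K j * ?c (r j) b) + ?c (r s) b)" if "b \<in> B" for b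
  proof -
    let ?z = "of_real \<tau> * l b"
    have lb: "l b \<in> complex_spectrum L" using eigenbasis_spectrum[OF B] that by simp
    then have st: "invertible_mat (stage_matrix s \<alpha> \<beta> ?z)" "cmod (stability_fun s \<alpha> \<beta> ?z) \<le> 1"
      using stable by (auto simp: stability_region_def)
    have "cinner (complex_vec (E s)) b = stability_fun s \<alpha> \<beta> ?z * cinner (complex_vec e) b
      + ((\<Sum>j<s. internal_stability_fun s \<alpha> \<beta> j ?z * cinner (complex_vec (r j)) b)
      + cinner (complex_vec (r s)) b)"
      using stage_eqs_final[OF st(1) rk_step_stage_eqs[OF B that step]] by simp
    also have "cmod \<dots> \<le> cmod (stability_fun s \<alpha> \<beta> ?z * cinner (complex_vec e) b)
      + (cmod (\<Sum>j<s. internal_stability_fun s \<alpha> \<beta> j ?z * cinner (complex_vec (r j)) b)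
      + ?c (r s) b)"
      by (intro order_trans[OF norm_triangle_ineq] add_left_mono norm_triangle_ineq)
    also have "\<dots> \<le> ?c e b + ((\<Sum>j<s. K j * ?c (r j) b) + ?c (r s) b)"
      using st(2) lb K
      by (intro add_mono order_trans[OF norm_sum] sum_mono order_refl)
         (auto simp: norm_mult intro!: mult_right_mono mult_left_le_one_le)
    finally show ?thesis .
  qed
  have "norm (E s) \<le> L2_set (\<lambda>b. ?c e b + ((\<Sum>j<s. K j * ?c (r j) b) + ?c (r s) b)) B"
    unfolding n by (intro L2_set_mono c) auto
  also have "\<dots> \<le> norm e + ((\<Sum>j<s. L2_set (\<lambda>b. K j * ?c (r j) b) B) + norm (r s))"
    unfolding n
    by (intro order_trans[OF L2_set_triangle_ineq] add_mono order_refl L2_set_sum_le)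
  also have "(\<Sum>j<s. L2_set (\<lambda>b. K j * ?c (r j) b) B) = (\<Sum>j<s. K j * norm (r j))"
    unfolding n by (intro sum.cong refl L2_set_right_distrib[symmetric] K0) auto
  finally show ?thesis by simp
qed

text \<open>
  The stages are assembled from the scalar solutions in the eigenbasis. Since the coefficients \<open>\<alpha>\<close>, \<open>\<beta>\<close>,
  the matrix \<open>L\<close> and the data are real, the real parts of a complex solution solve the equations again.
\<close>

lemma linear_step_exists:
  fixes L :: "real ^ 'm ^ 'm"
  assumes normal: "normal_matrix L"
    and stable: "(\<lambda>z. of_real \<tau> * z) ` complex_spectrum L \<subseteq> stability_region s \<alpha> \<beta>"
  obtains Y where "rk_step s \<alpha> \<beta> (\<lambda>_ x. L *v x) \<tau> t u r Y"
proof -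
  let ?A = "map_matrix complex_of_real L"
  obtain B l where B: "eigenbasis L B l" using normal_matrix_eigenbasis[OF normal] .
  have ex: "x = (\<Sum>b\<in>B. cinner x b *s b)" for x by (rule eigenbasisD(2)[OF B])
  have "\<exists>y. stage_eqs s \<alpha> \<beta> (of_real \<tau> * l b) (cinner (complex_vec u) b)
    (\<lambda>i. cinner (complex_vec (r i)) b) {..<s} y" if "b \<in> B" for b
    using that stable eigenbasis_spectrum[OF B]
    by (intro stage_eqs_solvable) (auto simp: stability_region_def)
  then obtain y where y: "\<And>b. b \<in> B \<Longrightarrow> stage_eqs s \<alpha> \<beta> (of_real \<tau> * l b)
      (cinner (complex_vec u) b) (\<lambda>i. cinner (complex_vec (r i)) b) {..<s} (y b)" by metis
  define Z where "Z j = (\<Sum>b\<in>B. y b j *s b)" for j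
  \<comment> \<open>\<open>Z\<close> are complex stages, \<open>X\<close> their real parts; row \<open>s\<close> is added in \<open>Y\<close>.\<close>
  define X :: "nat \<Rightarrow> real ^ 'm" where "X j = (\<chi> k. Re (Z j $ k))" for j
  have AZ: "?A *v Z j = (\<Sum>b\<in>B. (l b * y b j) *s b)" for j
    unfolding Z_def vec.sum
    by (intro sum.cong) (auto simp: vec.scale eigenbasisD(4)[OF B] vector_smult_assoc mult.commute)
  have Z: "Z i = of_real (so_v s \<alpha> i) *s complex_vec u
      + (\<Sum>j<s. of_real (\<alpha> $$ (i, j)) *s Z j + of_real (\<tau> * \<beta> $$ (i, j)) *s (?A *v Z j))
      + complex_vec (r i)" if "i < s" for i
  proof -
    have "Z i = (\<Sum>b\<in>B. (of_real (so_v s \<alpha> i) * cinner (complex_vec u) b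
     + (\<Sum>j<s. (of_real (\<alpha> $$ (i, j)) + of_real \<tau> * l b * of_real (\<beta> $$ (i, j))) * y b j)
     + cinner (complex_vec (r i)) b) *s b)"
      unfolding Z_def using y that by (intro sum.cong) (auto simp: stage_eqs_def)
    also have "\<dots> = of_real (so_v s \<alpha> i) *s (\<Sum>b\<in>B. cinner (complex_vec u) b *s b)
      + (\<Sum>b\<in>B. \<Sum>j<s. of_real (\<alpha> $$ (i, j)) *s (y b j *s b) + of_real (\<tau> * \<beta> $$ (i, j)) *s ((l b * y b j) *s b))
      + (\<Sum>b\<in>B. cinner (complex_vec (r i)) b *s b)"
      by (simp add: vec.scale_left_distrib vec.scale_sum_left vec.scale_sum_right sum.distrib
          vector_smult_assoc algebra_simps)
    also have "(\<Sum>b\<in>B. \<Sum>j<s. of_real (\<alpha> $$ (i, j)) *s (y b j *s b) + of_real (\<tau> * \<beta> $$ (i, j)) *s ((l b * y b j) *s b))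
       = (\<Sum>j<s. of_real (\<alpha> $$ (i, j)) *s Z j + of_real (\<tau> * \<beta> $$ (i, j)) *s (?A *v Z j))"
      by (subst sum.swap) (simp add: AZ, simp add: Z_def vec.scale_sum_right sum.distrib)
    finally show ?thesis by (simp flip: ex)
  qed
  have ReA: "(\<chi> k. Re ((?A *v Z j) $ k)) = L *v X j" for j
    by (simp add: Finite_Cartesian_Product.vec_eq_iff X_def matrix_vector_mult_def map_matrix_def)
  have X: "X i = so_v s \<alpha> i *\<^sub>R u
      + (\<Sum>j<s. (\<alpha> $$ (i, j)) *\<^sub>R X j + (\<tau> * \<beta> $$ (i, j)) *\<^sub>R (L *v X j)) + r i" if "i < s" for i
  proof -
    have "X i $ k = (so_v s \<alpha> i *\<^sub>R u
      + (\<Sum>j<s. (\<alpha> $$ (i, j)) *\<^sub>R X j + (\<tau> * \<beta> $$ (i, j)) *\<^sub>R (L *v X j)) + r i) $ k" for k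
      unfolding ReA[symmetric] using arg_cong[OF Z[OF that], of "\<lambda>x. Re (x $ k)"]
      by (simp add: X_def complex_vec_def)
    then show ?thesis by (simp add: Finite_Cartesian_Product.vec_eq_iff)
  qed
  define Y where "Y = X(s := so_v s \<alpha> s *\<^sub>R u
      + (\<Sum>j<s. (\<alpha> $$ (s, j)) *\<^sub>R X j + (\<tau> * \<beta> $$ (s, j)) *\<^sub>R (L *v X j)) + r s)"
  have "rk_step s \<alpha> \<beta> (\<lambda>_ x. L *v x) \<tau> t u r Y"
    unfolding rk_step_def
  proof (intro allI impI)
    fix i assume "i \<le> s"
    then consider "i < s" | "i = s" by linarith
    then show "Y i = so_v s \<alpha> i *\<^sub>R u
      + (\<Sum>j<s. (\<alpha> $$ (i, j)) *\<^sub>R Y j + (\<tau> * \<beta> $$ (i, j)) *\<^sub>R (L *v Y j)) + r i"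
      by cases (simp_all add: Y_def X[symmetric])
  qed
  then show thesis by (rule that)
qed

section \<open>Smoothness of the linear right-hand side\<close>

lemma Ck_const: "Ck n (\<lambda>_. c)"
  by (induction n arbitrary: c) (simp_all add: frechet_derivative_const)

lemma Ck_add: "Ck n f \<Longrightarrow> Ck n g \<Longrightarrow> Ck n (\<lambda>x. f x + g x)"
proof (induction n arbitrary: f g)
  case 0
  then show ?case by (simp add: continuous_on_add)
next
  case (Suc n)
  have d: "frechet_derivative (\<lambda>x. f x + g x) (at x)
      = (\<lambda>v. frechet_derivative f (at x) v + frechet_derivative g (at x) v)" for x
    using Suc.prems
    by (intro frechet_derivative_at[symmetric] has_derivative_add) (simp_all flip: frechet_derivative_works)
  show ?case using Suc by (simp add: d)
qed

lemma Ck_bounded_linear: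
  assumes "bounded_linear f"
  shows "Ck n f"
proof (cases n)
  case 0
  then show ?thesis using assms by (simp add: linear_continuous_on)
next
  case (Suc m)
  have d: "frechet_derivative f (at x) = f" for x
    by (rule frechet_derivative_at[symmetric], rule bounded_linear_imp_has_derivative, rule assms)
  show ?thesis using bounded_linear_imp_differentiable[OF assms] by (simp add: Suc d Ck_const)
qed

lemma Ck_compose_bounded_linear:
  assumes h: "bounded_linear h"
  shows "Ck n g \<Longrightarrow> Ck n (\<lambda>x. g (h x))"
proof (induction n arbitrary: g)
  case 0
  then show ?case
    using continuous_on_compose2[of UNIV g UNIV h] linear_continuous_on[OF h] by simp
next
  case (Suc n)
  have hd: "((\<lambda>x. g (h x)) has_derivative (\<lambda>v. frechet_derivative g (at (h x)) (h v))) (at x)" for x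
    using diff_chain_at[OF bounded_linear_imp_has_derivative[OF h], of g "frechet_derivative g (at (h x))" x]
      Suc.prems by (simp add: o_def frechet_derivative_works[symmetric])
  have d: "frechet_derivative (\<lambda>x. g (h x)) (at x) = (\<lambda>v. frechet_derivative g (at (h x)) (h v))" for x
    by (rule frechet_derivative_at[symmetric, OF hd])
  show ?case using Suc hd by (auto simp: d differentiable_def)
qed

text \<open>
  The order of a method is tested on right-hand sides that are smooth in \<open>t\<close> and \<open>u\<close> jointly.
\<close>

lemma smooth_linear_rhs:
  fixes L :: "real ^ 'm ^ 'm" and g :: "real \<Rightarrow> real ^ 'm"
  assumes "smooth_fun g"
  shows "smooth_fun (\<lambda>(t, u). L *v u + g t)"
proof -
  have "bounded_linear (\<lambda>x :: real \<times> (real ^ 'm). L *v snd x)"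
    by (intro bounded_linear_compose[OF matrix_vector_mul_bounded_linear] bounded_linear_snd)
  then have "Ck n (\<lambda>x :: real \<times> (real ^ 'm). L *v snd x)" for n
    by (rule Ck_bounded_linear)
  moreover have "Ck n (\<lambda>x :: real \<times> (real ^ 'm). g (fst x))" for n
    using assms by (intro Ck_compose_bounded_linear[OF bounded_linear_fst]) (simp add: smooth_fun_def)
  ultimately show ?thesis
    unfolding smooth_fun_def case_prod_unfold by (intro allI Ck_add)
qed

section \<open>Local errors and the inhomogeneous problem\<close>

text \<open>
  The abscissae do not depend on the stages, so the values of \<open>g\<close> may be counted as residuals of the
  homogeneous problem.
\<close>

lemma rk_step_affine_iff:
  fixes L :: "real ^ 'm ^ 'm"
  shows "rk_step s \<alpha> \<beta> (\<lambda>t x. L *v x + g t) \<tau> t u r Y \<longleftrightarrow>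
    rk_step s \<alpha> \<beta> (\<lambda>_ x. L *v x) \<tau> t u
      (\<lambda>i. r i + (\<Sum>j<s. (\<tau> * \<beta> $$ (i, j)) *\<^sub>R g (t + vec_index (abscissae s \<alpha> \<beta>) j * \<tau>))) Y"
  by (simp add: rk_step_def scaleR_add_right sum.distrib algebra_simps)

lemma rk_step_linear_diff:
  fixes L :: "real ^ 'm ^ 'm"
  assumes "rk_step s \<alpha> \<beta> (\<lambda>_ x. L *v x) \<tau> t u r Y" "rk_step s \<alpha> \<beta> (\<lambda>_ x. L *v x) \<tau> t u' r' Y'"
  shows "rk_step s \<alpha> \<beta> (\<lambda>_ x. L *v x) \<tau> t (u - u') (\<lambda>i. r i - r' i) (\<lambda>i. Y i - Y' i)"
  unfolding rk_step_def
proof (intro allI impI)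
  fix i assume "i \<le> s"
  with assms have
    "Y i = so_v s \<alpha> i *\<^sub>R u + (\<Sum>j<s. (\<alpha> $$ (i, j)) *\<^sub>R Y j + (\<tau> * \<beta> $$ (i, j)) *\<^sub>R (L *v Y j)) + r i"
    "Y' i = so_v s \<alpha> i *\<^sub>R u' + (\<Sum>j<s. (\<alpha> $$ (i, j)) *\<^sub>R Y' j + (\<tau> * \<beta> $$ (i, j)) *\<^sub>R (L *v Y' j)) + r' i"
    unfolding rk_step_def by blast+
  then have "Y i - Y' i = so_v s \<alpha> i *\<^sub>R u + (\<Sum>j<s. (\<alpha> $$ (i, j)) *\<^sub>R Y j + (\<tau> * \<beta> $$ (i, j)) *\<^sub>R (L *v Y j)) + r i
     - (so_v s \<alpha> i *\<^sub>R u' + (\<Sum>j<s. (\<alpha> $$ (i, j)) *\<^sub>R Y' j + (\<tau> * \<beta> $$ (i, j)) *\<^sub>R (L *v Y' j)) + r' i)"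
    by simp
  also have "\<dots> = so_v s \<alpha> i *\<^sub>R (u - u') + (\<Sum>j<s. (\<alpha> $$ (i, j)) *\<^sub>R (Y j - Y' j)
      + (\<tau> * \<beta> $$ (i, j)) *\<^sub>R (L *v (Y j - Y' j))) + (r i - r' i)"
    by (simp add: matrix_vector_mult_diff_distrib scaleR_diff_right sum_subtractf sum.distrib algebra_simps)
  finally show "Y i - Y' i = so_v s \<alpha> i *\<^sub>R (u - u') + (\<Sum>j<s. (\<alpha> $$ (i, j)) *\<^sub>R (Y j - Y' j)
      + (\<tau> * \<beta> $$ (i, j)) *\<^sub>R (L *v (Y j - Y' j))) + (r i - r' i)" .
qed

text \<open>
  The order condition says nothing about step sizes above some threshold. For such a fixed step size,
  the bound on one step, applied with the values of \<open>g\<close> as residuals, depends continuously on the time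
  \<open>t\<close>, which ranges over a compact interval.
\<close>

lemma local_error_bounded:
  fixes L :: "real ^ 'm ^ 'm"
  assumes normal: "normal_matrix L"
    and stable: "(\<lambda>z. of_real \<tau> * z) ` complex_spectrum L \<subseteq> stability_region s \<alpha> \<beta>"
    and g: "continuous_on UNIV g" and U: "continuous_on {t\<^sub>0..} U" and \<tau>: "0 < \<tau>"
  shows "\<exists>D. \<forall>t Y. t\<^sub>0 \<le> t \<and> t + \<tau> \<le> T \<and>
    rk_step s \<alpha> \<beta> (\<lambda>t x. L *v x + g t) \<tau> t (U t) (\<lambda>_. 0) Y \<longrightarrow> norm (Y s - U (t + \<tau>)) \<le> D"
proof -
  define K where "K j = Max ((\<lambda>z. cmod (internal_stability_fun s \<alpha> \<beta> j (of_real \<tau> * z))) ` complex_spectrum L)" for j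
  define G where "G t i = (\<Sum>j<s. (\<tau> * \<beta> $$ (i, j)) *\<^sub>R g (t + vec_index (abscissae s \<alpha> \<beta>) j * \<tau>))" for t i
  define h where "h t = norm (U t) + (\<Sum>j<s. K j * norm (G t j)) + norm (G t s) + norm (U (t + \<tau>))" for t
  note fin = spectrum_finite_nonempty(1)[OF normal]
  have G: "continuous_on {t\<^sub>0..T - \<tau>} (\<lambda>t. G t i)" for i
    unfolding G_def by (intro continuous_intros continuous_on_compose2[OF g]) auto
  have "continuous_on {t\<^sub>0..T - \<tau>} h"
    unfolding h_def using \<tau>
    by (intro continuous_intros G continuous_on_compose2[OF U] continuous_on_subset[OF U]) auto
  then have "bounded (h ` {t\<^sub>0..T - \<tau>})"
    by (intro compact_imp_bounded compact_continuous_image) auto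
  then obtain D where D: "\<And>t. t \<in> {t\<^sub>0..T - \<tau>} \<Longrightarrow> norm (h t) \<le> D"
    unfolding bounded_iff by blast
  have "norm (Y s - U (t + \<tau>)) \<le> D"
    if t: "t\<^sub>0 \<le> t" "t + \<tau> \<le> T" and Y: "rk_step s \<alpha> \<beta> (\<lambda>t x. L *v x + g t) \<tau> t (U t) (\<lambda>_. 0) Y" for t Y
  proof -
    have "rk_step s \<alpha> \<beta> (\<lambda>_ x. L *v x) \<tau> t (U t) (G t) Y"
      using Y unfolding rk_step_affine_iff G_def by simp
    then have "norm (Y s) \<le> norm (U t) + (\<Sum>j<s. K j * norm (G t j)) + norm (G t s)"
      by (intro linear_step_bound[OF normal stable]) (auto simp: K_def intro!: Max_ge fin)
    then have "norm (Y s - U (t + \<tau>)) \<le> h t"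
      using norm_triangle_ineq4[of "Y s" "U (t + \<tau>)"] by (simp add: h_def)
    also have "\<dots> \<le> D" using D[of t] t by auto
    finally show ?thesis .
  qed
  then show ?thesis by blast
qed

section \<open>The error bound\<close>

text \<open>
  The summand \<open>b\<close> stands for the residual of the final row, which is passed on with factor 1; the
  condition \<open>1 \<le> M\<close> lets it be counted as one further multiple of \<open>M * \<rho>\<close>. If \<open>M = \<infinity>\<close>, the right-hand
  side is infinite unless \<open>\<rho> = 0\<close>, when it is \<open>\<infinity> * 0 = 0\<close> and the left-hand side vanishes too.
\<close>

lemma amplification_sum_le:
  fixes M :: ereal
  assumes "finite J" and M: "1 \<le> M" and K: "\<And>j. j \<in> J \<Longrightarrow> ereal (K j) \<le> M"
    and a: "\<And>j. j \<in> J \<Longrightarrow> 0 \<le> a j \<and> a j \<le> \<rho>" and b: "0 \<le> b" "b \<le> \<rho>"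
  shows "ereal ((\<Sum>j\<in>J. K j * a j) + b) \<le> ereal (real (card J + 1)) * M * ereal \<rho>"
proof (cases M)
  case (real m)
  have "(\<Sum>j\<in>J. K j * a j) \<le> (\<Sum>j\<in>J. m * \<rho>)"
  proof (rule sum_mono)
    fix j assume j: "j \<in> J"
    have "K j * a j \<le> m * a j" using K[OF j] a[OF j] real by (simp add: mult_right_mono)
    also have "\<dots> \<le> m * \<rho>" using a[OF j] M real by (simp add: mult_left_mono)
    finally show "K j * a j \<le> m * \<rho>" .
  qed
  moreover have "b \<le> m * \<rho>" using M b real mult_right_mono[of 1 m \<rho>] by simp
  ultimately show ?thesis by (simp add: real algebra_simps)
next
  case PInf
  show ?thesis
  proof (cases "\<rho> = 0")
    case True
    then have "b = 0" "\<And>j. j \<in> J \<Longrightarrow> a j = 0" using a b by force+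
    then show ?thesis using True by (simp flip: zero_ereal_def)
  next
    case False
    then show ?thesis using b PInf by simp
  qed
qed (use M in simp)

text \<open>
  The initial error and the residuals propagate by the homogeneous step, compared with an unperturbed
  step \<open>V\<close> that starts on the exact solution. In the explicit case the residual of the first stage is
  zero, so one of the \<open>s + 1\<close> contributions disappears.
\<close>

theorem theorem2p3:
  fixes s p :: nat and \<alpha> \<beta> :: "real mat"
    and L :: "real ^ 'm ^ 'm" and g U :: "real \<Rightarrow> real ^ 'm"
    and t\<^sub>0 :: real and U\<^sub>0 :: "real ^ 'm"
  assumes "1 \<le> s"
    and "shu_osher s \<alpha> \<beta>"
    and "rk_order TYPE(real ^ 'm) s \<alpha> \<beta> p"
    and "normal_matrix L"
    and "smooth_fun g"
    and "U t\<^sub>0 = U\<^sub>0"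
    and "\<And>t. t\<^sub>0 \<le> t \<Longrightarrow> (U has_vector_derivative (L *v U t + g t)) (at t within {t\<^sub>0..})"
  shows "\<forall>T. \<exists>R \<in> O[at_right 0](\<lambda>\<tau>. \<tau> ^ (p + 1)).
    \<forall>\<tau> S t u r Y.
      0 < \<tau> \<and> t\<^sub>0 \<le> t \<and> t + \<tau> \<le> T \<and>
      (\<lambda>z. of_real \<tau> * z) ` complex_spectrum L \<subseteq> S \<and> S \<subseteq> stability_region s \<alpha> \<beta> \<and>
      1 \<le> max_internal_amplification s \<alpha> \<beta> S \<and>
      rk_step s \<alpha> \<beta> (\<lambda>t x. L *v x + g t) \<tau> t u r Y \<longrightarrow>
      ereal (norm (Y s - U (t + \<tau>)))
        \<le> ereal (norm (u - U t))
          + ereal (real (s + 1)) * max_internal_amplification s \<alpha> \<beta> S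
            * ereal (MAX j\<in>{..s}. norm (r j))
          + ereal (R \<tau>) \<and>
      (explicit_method s \<alpha> \<beta> \<and> r 0 = 0 \<longrightarrow>
        ereal (norm (Y s - U (t + \<tau>)))
          \<le> ereal (norm (u - U t))
            + ereal (real s) * max_internal_amplification s \<alpha> \<beta> S
              * ereal (MAX j\<in>{..s}. norm (r j))
            + ereal (R \<tau>))"
proof
  fix T
  let ?F = "\<lambda>t x. L *v x + g t"
  define stable where "stable \<tau> \<longleftrightarrow>
    (\<lambda>z. of_real \<tau> * z) ` complex_spectrum L \<subseteq> stability_region s \<alpha> \<beta>" for \<tau>
  define local_bound where "local_bound \<tau> D \<longleftrightarrow> (\<forall>t Y. t\<^sub>0 \<le> t \<and> t + \<tau> \<le> T \<and>
    rk_step s \<alpha> \<beta> ?F \<tau> t (U t) (\<lambda>_. 0) Y \<longrightarrow> norm (Y s - U (t + \<tau>)) \<le> D)" for \<tau> D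
  have g: "continuous_on UNIV g"
    using spec[OF assms(5)[unfolded smooth_fun_def], of 0] by simp
  have U: "continuous_on {t\<^sub>0..} U"
    using assms(7) by (intro continuous_on_vector_derivative) auto
  have "\<exists>D. 0 < \<tau> \<and> stable \<tau> \<longrightarrow> local_bound \<tau> D" for \<tau>
    using local_error_bounded[OF assms(4) _ g U, of \<tau> s \<alpha> \<beta> T]
    unfolding stable_def local_bound_def by blast
  then obtain D where D: "\<And>\<tau>. 0 < \<tau> \<Longrightarrow> stable \<tau> \<Longrightarrow> local_bound \<tau> (D \<tau>)" by metis
  have "\<exists>K. \<forall>t u w. norm (?F t u - ?F t w) \<le> K * norm (u - w)"
    by (intro exI[of _ "onorm ((*v) L)"])
       (simp flip: matrix_vector_mult_diff_distrib add: onorm matrix_vector_mul_bounded_linear)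
  moreover have "\<forall>t\<in>{t\<^sub>0..T}. (U has_vector_derivative ?F t (U t)) (at t within {t\<^sub>0..T})"
    using assms(7) has_vector_derivative_within_subset[of U _ _ "{t\<^sub>0..}" "{t\<^sub>0..T}"] by auto
  ultimately obtain C \<tau>\<^sub>0 where \<tau>\<^sub>0: "\<tau>\<^sub>0 > 0"
    and C: "\<And>\<tau>. 0 < \<tau> \<Longrightarrow> \<tau> \<le> \<tau>\<^sub>0 \<Longrightarrow> local_bound \<tau> (C * \<tau> ^ (p + 1))"
    using assms(3)[unfolded rk_order_def, rule_format, of ?F t\<^sub>0 T U] smooth_linear_rhs[OF assms(5), of L]
    unfolding local_bound_def by blast
  \<comment> \<open>Above \<open>\<tau>\<^sub>0\<close>, any finite bound will do: the \<open>O\<close>-term concerns only \<open>\<tau> \<rightarrow> 0\<close>.\<close>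
  define R where "R \<tau> = (if \<tau> \<le> \<tau>\<^sub>0 then C * \<tau> ^ (p + 1) else D \<tau>)" for \<tau>
  have R: "local_bound \<tau> (R \<tau>)" if "0 < \<tau>" "stable \<tau>" for \<tau>
    using C D that by (simp add: R_def)
  have "\<forall>\<^sub>F \<tau> in at_right 0. norm (R \<tau>) \<le> \<bar>C\<bar> * norm (\<tau> ^ (p + 1))"
    using eventually_at_right_real[OF \<tau>\<^sub>0]
    by eventually_elim (simp add: R_def abs_mult)
  then have "R \<in> O[at_right 0](\<lambda>\<tau>. \<tau> ^ (p + 1))" by (rule bigoI)
  moreover have "ereal (norm (Y s - U (t + \<tau>)))
        \<le> ereal (norm (u - U t))
          + ereal (real (s + 1)) * max_internal_amplification s \<alpha> \<beta> S
            * ereal (MAX j\<in>{..s}. norm (r j))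
          + ereal (R \<tau>) \<and>
      (explicit_method s \<alpha> \<beta> \<and> r 0 = 0 \<longrightarrow>
        ereal (norm (Y s - U (t + \<tau>)))
          \<le> ereal (norm (u - U t))
            + ereal (real s) * max_internal_amplification s \<alpha> \<beta> S
              * ereal (MAX j\<in>{..s}. norm (r j))
            + ereal (R \<tau>))"
    if \<tau>: "0 < \<tau>" and t: "t\<^sub>0 \<le> t" "t + \<tau> \<le> T"
      and S: "(\<lambda>z. of_real \<tau> * z) ` complex_spectrum L \<subseteq> S" "S \<subseteq> stability_region s \<alpha> \<beta>"
      and M: "1 \<le> max_internal_amplification s \<alpha> \<beta> S"
      and Y: "rk_step s \<alpha> \<beta> ?F \<tau> t u r Y"
    for \<tau> S t u r Y
  proof -
    let ?M = "max_internal_amplification s \<alpha> \<beta> S"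
    \<comment> \<open>The maximum over the finite spectrum is finite even when the supremum over \<open>S\<close> is not.\<close>
    define K where "K j = Max ((\<lambda>z. cmod (internal_stability_fun s \<alpha> \<beta> j (of_real \<tau> * z))) ` complex_spectrum L)" for j
    define \<rho> where "\<rho> = (MAX j\<in>{..s}. norm (r j))"
    have stab: "(\<lambda>z. of_real \<tau> * z) ` complex_spectrum L \<subseteq> stability_region s \<alpha> \<beta>"
      using S by blast
    have \<rho>: "norm (r j) \<le> \<rho>" if "j \<le> s" for j
      unfolding \<rho>_def using that by (intro Max_ge) auto
    note spec = spectrum_finite_nonempty[OF assms(4)]
    have K: "ereal (K j) \<le> ?M" if "j < s" for j
    proof -
      have "K j \<in> (\<lambda>z. cmod (internal_stability_fun s \<alpha> \<beta> j (of_real \<tau> * z))) ` complex_spectrum L"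
        unfolding K_def using spec by (intro Max_in) auto
      then obtain z where z: "z \<in> S" "K j = cmod (internal_stability_fun s \<alpha> \<beta> j z)"
        using S(1) by auto
      have "ereal (K j) \<le> (SUP z\<in>S. ereal (cmod (internal_stability_fun s \<alpha> \<beta> j z)))"
        unfolding z(2) by (rule SUP_upper[OF z(1)])
      also have "\<dots> \<le> ?M"
        unfolding max_internal_amplification_def using that by (intro Max_ge) auto
      finally show ?thesis .
    qed
    define G where "G i = (\<Sum>j<s. (\<tau> * \<beta> $$ (i, j)) *\<^sub>R g (t + vec_index (abscissae s \<alpha> \<beta>) j * \<tau>))" for i
    obtain V where V: "rk_step s \<alpha> \<beta> (\<lambda>_ x. L *v x) \<tau> t (U t) G V"
      using linear_step_exists[OF assms(4) stab] .
    then have "rk_step s \<alpha> \<beta> ?F \<tau> t (U t) (\<lambda>_. 0) V"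
      unfolding rk_step_affine_iff G_def by simp
    then have local: "norm (V s - U (t + \<tau>)) \<le> R \<tau>"
      using R[OF \<tau>] stab t unfolding stable_def local_bound_def by blast
    have "rk_step s \<alpha> \<beta> (\<lambda>_ x. L *v x) \<tau> t u (\<lambda>i. r i + G i) Y"
      using Y unfolding rk_step_affine_iff G_def .
    from rk_step_linear_diff[OF this V]
    have "rk_step s \<alpha> \<beta> (\<lambda>_ x. L *v x) \<tau> t (u - U t) r (\<lambda>i. Y i - V i)" by simp
    then have "norm (Y s - V s) \<le> norm (u - U t) + (\<Sum>j<s. K j * norm (r j)) + norm (r s)"
      by (intro linear_step_bound[OF assms(4) stab]) (auto simp: K_def intro!: Max_ge spec)
    then have err: "norm (Y s - U (t + \<tau>)) \<le>
        norm (u - U t) + ((\<Sum>j<s. K j * norm (r j)) + norm (r s)) + R \<tau>"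
      using norm_triangle_ineq[of "Y s - V s" "V s - U (t + \<tau>)"] local by simp
    \<comment> \<open>\<open>J\<close> contains the stages with a possibly nonzero residual.\<close>
    have concl: "ereal (norm (Y s - U (t + \<tau>)))
        \<le> ereal (norm (u - U t)) + ereal (real (card J + 1)) * ?M * ereal \<rho> + ereal (R \<tau>)"
      if J: "J \<subseteq> {..<s}" "(\<Sum>j<s. K j * norm (r j)) = (\<Sum>j\<in>J. K j * norm (r j))" for J
    proof -
      have "ereal ((\<Sum>j\<in>J. K j * norm (r j)) + norm (r s))
          \<le> ereal (real (card J + 1)) * ?M * ereal \<rho>"
      proof (rule amplification_sum_le[OF _ M])
        show "finite J" using J(1) by (rule finite_subset) simp
        show "ereal (K j) \<le> ?M" "0 \<le> norm (r j) \<and> norm (r j) \<le> \<rho>" if "j \<in> J" for j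
          using that J(1) K \<rho>[of j] by (auto simp: subset_iff)
      qed (simp_all add: \<rho>)
      moreover have "ereal (norm (Y s - U (t + \<tau>))) \<le> ereal (norm (u - U t))
          + ereal ((\<Sum>j\<in>J. K j * norm (r j)) + norm (r s)) + ereal (R \<tau>)"
        using err by (simp add: J(2))
      ultimately show ?thesis by (meson add_left_mono add_right_mono order_trans)
    qed
    show ?thesis
    proof (intro conjI impI)
      show "ereal (norm (Y s - U (t + \<tau>))) \<le> ereal (norm (u - U t))
          + ereal (real (s + 1)) * ?M * ereal (MAX j\<in>{..s}. norm (r j)) + ereal (R \<tau>)"
        using concl[of "{..<s}"] by (simp add: \<rho>_def)
    next
      assume "explicit_method s \<alpha> \<beta> \<and> r 0 = 0"
      then have "(\<Sum>j<s. K j * norm (r j)) = (\<Sum>j\<in>{1..<s}. K j * norm (r j))"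
        by (intro sum.mono_neutral_right) (auto simp: not_less_eq_eq)
      then show "ereal (norm (Y s - U (t + \<tau>))) \<le> ereal (norm (u - U t))
          + ereal (real s) * ?M * ereal (MAX j\<in>{..s}. norm (r j)) + ereal (R \<tau>)"
        using concl[of "{1..<s}"] assms(1) unfolding \<rho>_def by force
    qed
  qed
  ultimately show "\<exists>R \<in> O[at_right 0](\<lambda>\<tau>. \<tau> ^ (p + 1)).
    \<forall>\<tau> S t u r Y.
      0 < \<tau> \<and> t\<^sub>0 \<le> t \<and> t + \<tau> \<le> T \<and>
      (\<lambda>z. of_real \<tau> * z) ` complex_spectrum L \<subseteq> S \<and> S \<subseteq> stability_region s \<alpha> \<beta> \<and>
      1 \<le> max_internal_amplification s \<alpha> \<beta> S \<and>
      rk_step s \<alpha> \<beta> ?F \<tau> t u r Y \<longrightarrow>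
      ereal (norm (Y s - U (t + \<tau>)))
        \<le> ereal (norm (u - U t))
          + ereal (real (s + 1)) * max_internal_amplification s \<alpha> \<beta> S
            * ereal (MAX j\<in>{..s}. norm (r j))
          + ereal (R \<tau>) \<and>
      (explicit_method s \<alpha> \<beta> \<and> r 0 = 0 \<longrightarrow>
        ereal (norm (Y s - U (t + \<tau>)))
          \<le> ereal (norm (u - U t))
            + ereal (real s) * max_internal_amplification s \<alpha> \<beta> S
              * ereal (MAX j\<in>{..s}. norm (r j))
            + ereal (R \<tau>))"
    by (intro bexI[of _ R]) blast+
qed

end
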